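(* Let $(A,\prec,\succ,\alpha,\beta)$ be a BiHom-pre-alternative algebra, $(V,L_\prec,R_\prec,L_\succ,R_\succ,\phi,\psi)$ a bimodule of it, and $T:V\to A$ an $\mathcal O$-operator of $(A,\prec,\succ,\alpha,\beta)$ associated to this bimodule. Then: (1) $(V,\nwarrow,\swarrow,\nearrow,\searrow,\phi,\psi)$ is a BiHom-alternative quadri-algebra, where for all $u,v\in V$ $$u\searrow v=L_\succ(T(u))v,\quad u\nearrow v=R_\succ(T(v))u,\quad u\swarrow v=L_\prec(T(u))v,\quad u\nwarrow v=R_\prec(T(v))u.$$ (2) Therefore $V$, with structure maps $\phi,\psi$, is a BiHom-pre-alternative algebra for $u\prec v=u\swarrow v+u\nwarrow v$ and $u\succ v=u\searrow v+u\nearrow v$, and $T$ is a homomorphism of BiHom-pre-alternative algebras from it to $(A,\prec,\succ,\alpha,\beta)$. (3) $T(V)=\{T(v):v\in V\}\subset A$ is a BiHom-pre-alternative subalgebra of $A$, and there is an induced BiHom-alternative quadri-algebra structure on $T(V)$ (with structure maps $\alpha,\beta$) given, for all $u,v\in V$, by $T(u)\searrow T(v)=T(u\searrow v)$, $T(u)\nearrow T(v)=T(u\nearrow v)$, $T(u)\swarrow T(v)=T(u\swarrow v)$, $T(u)\nwarrow T(v)=T(u\nwarrow v)$. (4) The horizontal BiHom-pre-alternative algebra structure associated to this quadri-algebra structure on $T(V)$ is just the BiHom-pre-alternative subalgebra structure of $(A,\prec,\succ,\alpha,\beta)$ on $T(V)$, and $T:V\to T(V)$ is a BiHom-alternative quadri-algebra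 homomorphism.
   Context: $\mathbb K$ is a field of characteristic $0$; all vector spaces are over $\mathbb K$; $gl(V)$ is the space of linear endomorphisms of $V$. A BiHom-pre-alternative algebra is a tuple $(A,\prec,\succ,\alpha,\beta)$ with $A$ a vector space, $\prec,\succ:A\times A\to A$ bilinear, $\alpha,\beta:A\to A$ commuting linear maps, each multiplicative for both $\prec$ and $\succ$, such that, writing $x\circ y=x\prec y+x\succ y$ and $as^r_{\alpha,\beta}(x,y,z)=(x\prec y)\prec\beta(z)-\alpha(x)\prec(y\circ z)$, $as^m_{\alpha,\beta}(x,y,z)=(x\succ y)\prec\beta(z)-\alpha(x)\succ(y\prec z)$, $as^l_{\alpha,\beta}(x,y,z)=(x\circ y)\succ\beta(z)-\alpha(x)\succ(y\succ z)$, for all $x,y,z\in A$: - $as^r_{\alpha,\beta}(x,\beta(y),\alpha(z))+as^r_{\alpha,\beta}(x,\beta(z),\alpha(y))=0$; - $as^l_{\alpha,\beta}(\beta(x),\alpha(y),z)+as^l_{\alpha,\beta}(\beta(y),\alpha(x),z)=0$; - $as^m_{\alpha,\beta}(\beta(x),\alpha(y),z)+as^r_{\alpha,\beta}(\beta(y),\alpha(x),z)=0$; - $as^m_{\alpha,\beta}(x,\beta(y),\alpha(z))+as^l_{\alpha,\beta}(x,\beta(z),\alpha(y))=0$. A homomorphism of BiHom-pre-alternative algebras is a linear map preserving $\prec,\succ$ and intertwining the structure maps. A subalgebra is a subspace closed under $\prec,\succ$ and stable under $\alpha,\beta$. A bimodule of $(A,\prec,\succ,\alpha,\beta)$ is a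 vector space $V$ with two commuting linear maps $\phi,\psi:V\to V$ and four linear maps $L_\succ,L_\prec,R_\succ,R_\prec:A\to gl(V)$ such that, with $L_\circ=L_\prec+L_\succ$, $R_\circ=R_\prec+R_\succ$, for all $x,y\in A$: - $\phi F(x)=F(\alpha(x))\phi$ and $\psi F(x)=F(\beta(x))\psi$ for each $F\in\{L_\prec,R_\prec,L_\succ,R_\succ\}$; - $L_\succ(\beta(x)\circ\alpha(x))\psi=L_\succ(\alpha\beta(x))L_\succ(\alpha(x))$; - $R_\succ(\beta(y))(L_\circ(\beta(x))\phi+R_\circ(\alpha(x))\psi)=L_\succ(\alpha\beta(x))R_\succ(y)\phi+R_\succ(\alpha(x)\succ y)\phi\psi$; - $R_\prec(\alpha\beta(x))R_\prec(\beta(x))=R_\prec(\beta(x)\circ\alpha(x))\phi$; - $L_\prec(\alpha(y))(L_\circ(\beta(x))\phi+R_\circ(\alpha(x))\psi)=L_\prec(y\prec\beta(x))\phi\psi+R_\prec(\alpha\beta(x))L_\prec(y)\psi$; - $L_\prec(\beta(x)\succ\alpha(y)+\beta(y)\prec\alpha(x))\psi=L_\succ(\alpha\beta(x))L_\prec(\alpha(y))+L_\prec(\alpha\beta(y))L_\circ(\alpha(x))$; - $R_\prec(\beta(y))(L_\succ(\beta(x))\phi+R_\prec(\alpha(x))\psi)=L_\succ(\alpha\beta(x))R_\prec(y)\phi+R_\prec(\alpha(x)\circ y)\phi\psi$; - $R_\prec(\beta(y))(R_\succ(\alpha(x))\psi+L_\prec(\beta(x))\phi)=R_\succ(\alpha(x)\prec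 y)\phi\psi+L_\prec(\alpha\beta(x))R_\circ(y)\phi$; - $R_\prec(\alpha\beta(y))R_\succ(\beta(x))+R_\succ(\alpha\beta(x))R_\circ(\beta(y))=R_\succ(\beta(x)\prec\alpha(y))\phi+R_\succ(\beta(y)\succ\alpha(x))\phi$; - $R_\prec(\alpha\beta(y))L_\succ(x)\psi+L_\succ(x\circ\beta(y))\phi\psi=L_\succ(\alpha(x))(R_\prec(\alpha(y))\psi+L_\succ(\beta(y))\phi)$; - $L_\prec(x\succ\beta(y))\phi\psi+R_\succ(\alpha\beta(y))L_\circ(x)\psi=L_\succ(\alpha(x))L_\prec(\beta(y))\phi+L_\succ(\alpha(x))R_\succ(\alpha(y))\psi$. An $\mathcal O$-operator of $(A,\prec,\succ,\alpha,\beta)$ associated to a bimodule $(V,L_\prec,R_\prec,L_\succ,R_\succ,\phi,\psi)$ is a linear map $T:V\to A$ with $T\phi=\alpha T$, $T\psi=\beta T$, $T(u)\succ T(v)=T(L_\succ(T(u))v+R_\succ(T(v))u)$ and $T(u)\prec T(v)=T(L_\prec(T(u))v+R_\prec(T(v))u)$ for all $u,v\in V$. A BiHom-alternative quadri-algebra is a tuple $(A,\nwarrow,\swarrow,\nearrow,\searrow,\alpha,\beta)$ with $A$ a vector space, four bilinear operations $A\times A\to A$, and two commuting linear maps $\alpha,\beta:A\to A$ multiplicative for all four operations, such that, with $\succ,\prec,\vee,\wedge,\ast$ defined by $x\succ y=x\nearrow y+x\searrow y$, $x\prec y=x\nwarrow y+x\swarrow y$, $x\vee y=x\searrow y+x\swarrow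 y$, $x\wedge y=x\nearrow y+x\nwarrow y$, $x\ast y=x\searrow y+x\nearrow y+x\swarrow y+x\nwarrow y$, and (dropping subscripts $\alpha,\beta$) $\{x,y,z\}^r=(x\nwarrow y)\nwarrow\beta(z)-\alpha(x)\nwarrow(y\ast z)$, $\{x,y,z\}^l=(x\ast y)\searrow\beta(z)-\alpha(x)\searrow(y\searrow z)$, $\{x,y,z\}^{ne}=(x\wedge y)\nearrow\beta(z)-\alpha(x)\nearrow(y\succ z)$, $\{x,y,z\}^{sw}=(x\prec y)\swarrow\beta(z)-\alpha(x)\swarrow(y\vee z)$, $\{x,y,z\}^n=(x\nearrow y)\nwarrow\beta(z)-\alpha(x)\nearrow(y\prec z)$, $\{x,y,z\}^w=(x\swarrow y)\nwarrow\beta(z)-\alpha(x)\swarrow(y\wedge z)$, $\{x,y,z\}^s=(x\succ y)\swarrow\beta(z)-\alpha(x)\searrow(y\swarrow z)$, $\{x,y,z\}^e=(x\vee y)\nearrow\beta(z)-\alpha(x)\searrow(y\nearrow z)$, $\{x,y,z\}^m=(x\searrow y)\nwarrow\beta(z)-\alpha(x)\searrow(y\nwarrow z)$, for all $x,y,z\in A$: - $\{\beta(x),\alpha(y),z\}^p+\{\beta(y),\alpha(x),z\}^q=0$ for $(p,q)\in\{(r,m),(n,w),(ne,e),(sw,s),(l,l)\}$; - $\{x,\beta(y),\alpha(z)\}^p+\{x,\beta(z),\alpha(y)\}^q=0$ for $(p,q)\in\{(r,r),(n,ne),(w,sw),(m,l),(s,e)\}$. Its associated horizontal BiHom-pre-alternative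 algebra is $(A,\prec,\succ,\alpha,\beta)$ with these $\prec,\succ$. A homomorphism of BiHom-alternative quadri-algebras is a linear map preserving the four operations and intertwining the structure maps. *)

theory Defs
  imports Complex_Main
begin

text \<open>
  The ground field is a type \<open>'k\<close> of class \<^class>\<open>field_char_0\<close>, and a vector space is a subspace
  \<open>S\<close> of a type equipped with a scalar multiplication satisfying \<^locale>\<open>vector_space\<close>.  The choice
  \<open>S = UNIV\<close> gives arbitrary vector spaces; a proper \<open>S\<close> is needed for structures living on a
  subspace of another algebra.  Operations and maps on \<open>S\<close> are total functions whose values
  outside \<open>S\<close> are irrelevant.
\<close>

definition linear_on ::
  "('k::field \<Rightarrow> 'a::ab_group_add \<Rightarrow> 'a) \<Rightarrow> 'a set \<Rightarrow>
   ('k \<Rightarrow> 'b::ab_group_add \<Rightarrow> 'b) \<Rightarrow> 'b set \<Rightarrow> ('a \<Rightarrow> 'b) \<Rightarrow> bool" where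
  "linear_on s1 S1 s2 S2 f \<longleftrightarrow>
     (\<forall>x\<in>S1. f x \<in> S2) \<and>
     (\<forall>x\<in>S1. \<forall>y\<in>S1. f (x + y) = f x + f y) \<and>
     (\<forall>c. \<forall>x\<in>S1. f (s1 c x) = s2 c (f x))"

definition bilinear_on ::
  "('k::field \<Rightarrow> 'a::ab_group_add \<Rightarrow> 'a) \<Rightarrow> 'a set \<Rightarrow> ('a \<Rightarrow> 'a \<Rightarrow> 'a) \<Rightarrow> bool" where
  "bilinear_on s S m \<longleftrightarrow>
     (\<forall>x\<in>S. linear_on s S s S (m x)) \<and> (\<forall>y\<in>S. linear_on s S s S (\<lambda>x. m x y))"

text \<open>A linear map \<open>F: A \<rightarrow> gl(V)\<close>, where \<open>gl(V)\<close> carries the pointwise operations.\<close>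

definition linear_into_gl ::
  "('k::field \<Rightarrow> 'a::ab_group_add \<Rightarrow> 'a) \<Rightarrow> ('k \<Rightarrow> 'v::ab_group_add \<Rightarrow> 'v) \<Rightarrow>
   ('a \<Rightarrow> 'v \<Rightarrow> 'v) \<Rightarrow> bool" where
  "linear_into_gl sA sV F \<longleftrightarrow>
     (\<forall>x. Vector_Spaces.linear sV sV (F x)) \<and> (\<forall>v. Vector_Spaces.linear sA sV (\<lambda>x. F x v))"


section \<open>BiHom-pre-alternative algebras\<close>

locale pre_alternative_ops =
  fixes prec :: "'a::ab_group_add \<Rightarrow> 'a \<Rightarrow> 'a" (infixl \<open>\<prec>\<close> 70)
    and succ :: "'a \<Rightarrow> 'a \<Rightarrow> 'a" (infixl \<open>\<succ>\<close> 70)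
    and \<alpha> :: "'a \<Rightarrow> 'a"
    and \<beta> :: "'a \<Rightarrow> 'a"
begin

definition circ :: "'a \<Rightarrow> 'a \<Rightarrow> 'a" (infixl \<open>\<odot>\<close> 70)
  where "x \<odot> y = x \<prec> y + x \<succ> y"

definition as_r :: "'a \<Rightarrow> 'a \<Rightarrow> 'a \<Rightarrow> 'a"
  where "as_r x y z = (x \<prec> y) \<prec> \<beta> z - \<alpha> x \<prec> (y \<odot> z)"

definition as_m :: "'a \<Rightarrow> 'a \<Rightarrow> 'a \<Rightarrow> 'a"
  where "as_m x y z = (x \<succ> y) \<prec> \<beta> z - \<alpha> x \<succ> (y \<prec> z)"

definition as_l :: "'a \<Rightarrow> 'a \<Rightarrow> 'a \<Rightarrow> 'a"
  where "as_l x y z = (x \<odot> y) \<succ> \<beta> z - \<alpha> x \<succ> (y \<succ> z)"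

end

locale bihom_pre_alternative =
  vector_space scale + pre_alternative_ops prec succ \<alpha> \<beta>
  for scale :: "'k::field_char_0 \<Rightarrow> 'a::ab_group_add \<Rightarrow> 'a"
    and S :: "'a set"
    and prec :: "'a \<Rightarrow> 'a \<Rightarrow> 'a" (infixl \<open>\<prec>\<close> 70)
    and succ :: "'a \<Rightarrow> 'a \<Rightarrow> 'a" (infixl \<open>\<succ>\<close> 70)
    and \<alpha> :: "'a \<Rightarrow> 'a"
    and \<beta> :: "'a \<Rightarrow> 'a" +
  assumes subspace_carrier: "subspace S"
    and bilinear_prec: "bilinear_on scale S (\<prec>)"
    and bilinear_succ: "bilinear_on scale S (\<succ>)"
    and linear_\<alpha>: "linear_on scale S scale S \<alpha>"
    and linear_\<beta>: "linear_on scale S scale S \<beta>"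
    and \<alpha>_\<beta>_commute: "x \<in> S \<Longrightarrow> \<alpha> (\<beta> x) = \<beta> (\<alpha> x)"
    and \<alpha>_prec: "\<lbrakk>x \<in> S; y \<in> S\<rbrakk> \<Longrightarrow> \<alpha> (x \<prec> y) = \<alpha> x \<prec> \<alpha> y"
    and \<alpha>_succ: "\<lbrakk>x \<in> S; y \<in> S\<rbrakk> \<Longrightarrow> \<alpha> (x \<succ> y) = \<alpha> x \<succ> \<alpha> y"
    and \<beta>_prec: "\<lbrakk>x \<in> S; y \<in> S\<rbrakk> \<Longrightarrow> \<beta> (x \<prec> y) = \<beta> x \<prec> \<beta> y"
    and \<beta>_succ: "\<lbrakk>x \<in> S; y \<in> S\<rbrakk> \<Longrightarrow> \<beta> (x \<succ> y) = \<beta> x \<succ> \<beta> y"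
    and as_r_r: "\<lbrakk>x \<in> S; y \<in> S; z \<in> S\<rbrakk> \<Longrightarrow> as_r x (\<beta> y) (\<alpha> z) + as_r x (\<beta> z) (\<alpha> y) = 0"
    and as_l_l: "\<lbrakk>x \<in> S; y \<in> S; z \<in> S\<rbrakk> \<Longrightarrow> as_l (\<beta> x) (\<alpha> y) z + as_l (\<beta> y) (\<alpha> x) z = 0"
    and as_m_r: "\<lbrakk>x \<in> S; y \<in> S; z \<in> S\<rbrakk> \<Longrightarrow> as_m (\<beta> x) (\<alpha> y) z + as_r (\<beta> y) (\<alpha> x) z = 0"
    and as_m_l: "\<lbrakk>x \<in> S; y \<in> S; z \<in> S\<rbrakk> \<Longrightarrow> as_m x (\<beta> y) (\<alpha> z) + as_l x (\<beta> z) (\<alpha> y) = 0"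

text \<open>
  A homomorphism from \<open>(S, prec, succ, \<alpha>, \<beta>)\<close> to \<open>(S', prec', succ', \<alpha>', \<beta>')\<close>; that both sides are
  algebras is not part of the definition.
\<close>

definition bihom_pre_alternative_hom ::
  "('k::field_char_0 \<Rightarrow> 'a::ab_group_add \<Rightarrow> 'a) \<Rightarrow> 'a set \<Rightarrow>
     ('a \<Rightarrow> 'a \<Rightarrow> 'a) \<Rightarrow> ('a \<Rightarrow> 'a \<Rightarrow> 'a) \<Rightarrow> ('a \<Rightarrow> 'a) \<Rightarrow> ('a \<Rightarrow> 'a) \<Rightarrow>
   ('k \<Rightarrow> 'b::ab_group_add \<Rightarrow> 'b) \<Rightarrow> 'b set \<Rightarrow>
     ('b \<Rightarrow> 'b \<Rightarrow> 'b) \<Rightarrow> ('b \<Rightarrow> 'b \<Rightarrow> 'b) \<Rightarrow> ('b \<Rightarrow> 'b) \<Rightarrow> ('b \<Rightarrow> 'b) \<Rightarrow>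
   ('a \<Rightarrow> 'b) \<Rightarrow> bool" where
  "bihom_pre_alternative_hom s S prec succ \<alpha> \<beta> s' S' prec' succ' \<alpha>' \<beta>' f \<longleftrightarrow>
     linear_on s S s' S' f \<and>
     (\<forall>x\<in>S. \<forall>y\<in>S. f (prec x y) = prec' (f x) (f y)) \<and>
     (\<forall>x\<in>S. \<forall>y\<in>S. f (succ x y) = succ' (f x) (f y)) \<and>
     (\<forall>x\<in>S. f (\<alpha> x) = \<alpha>' (f x)) \<and>
     (\<forall>x\<in>S. f (\<beta> x) = \<beta>' (f x))"

definition bihom_pre_alternative_subalgebra ::
  "('k::field_char_0 \<Rightarrow> 'a::ab_group_add \<Rightarrow> 'a) \<Rightarrow> 'a set \<Rightarrow>
     ('a \<Rightarrow> 'a \<Rightarrow> 'a) \<Rightarrow> ('a \<Rightarrow> 'a \<Rightarrow> 'a) \<Rightarrow> ('a \<Rightarrow> 'a) \<Rightarrow> ('a \<Rightarrow> 'a) \<Rightarrow> 'a set \<Rightarrow> bool" where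
  "bihom_pre_alternative_subalgebra s S prec succ \<alpha> \<beta> B \<longleftrightarrow>
     B \<subseteq> S \<and> module.subspace s B \<and>
     (\<forall>x\<in>B. \<forall>y\<in>B. prec x y \<in> B) \<and>
     (\<forall>x\<in>B. \<forall>y\<in>B. succ x y \<in> B) \<and>
     (\<forall>x\<in>B. \<alpha> x \<in> B) \<and>
     (\<forall>x\<in>B. \<beta> x \<in> B)"


section \<open>Bimodules and O-operators\<close>

locale bimodule_ops =
  fixes Lprec :: "'a \<Rightarrow> 'v::ab_group_add \<Rightarrow> 'v" (\<open>L\<^sub>\<prec>\<close>)
    and Rprec :: "'a \<Rightarrow> 'v \<Rightarrow> 'v" (\<open>R\<^sub>\<prec>\<close>)
    and Lsucc :: "'a \<Rightarrow> 'v \<Rightarrow> 'v" (\<open>L\<^sub>\<succ>\<close>)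
    and Rsucc :: "'a \<Rightarrow> 'v \<Rightarrow> 'v" (\<open>R\<^sub>\<succ>\<close>)
begin

definition Lcirc :: "'a \<Rightarrow> 'v \<Rightarrow> 'v" (\<open>L\<^sub>\<odot>\<close>)
  where "L\<^sub>\<odot> x v = L\<^sub>\<prec> x v + L\<^sub>\<succ> x v"

definition Rcirc :: "'a \<Rightarrow> 'v \<Rightarrow> 'v" (\<open>R\<^sub>\<odot>\<close>)
  where "R\<^sub>\<odot> x v = R\<^sub>\<prec> x v + R\<^sub>\<succ> x v"

end

locale bihom_pre_alternative_bimodule =
  A: bihom_pre_alternative scaleA UNIV prec succ \<alpha> \<beta> + V: vector_space scaleV +
  bimodule_ops Lprec Rprec Lsucc Rsucc
  for scaleA :: "'k::field_char_0 \<Rightarrow> 'a::ab_group_add \<Rightarrow> 'a"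
    and prec :: "'a \<Rightarrow> 'a \<Rightarrow> 'a" (infixl \<open>\<prec>\<close> 70)
    and succ :: "'a \<Rightarrow> 'a \<Rightarrow> 'a" (infixl \<open>\<succ>\<close> 70)
    and \<alpha> :: "'a \<Rightarrow> 'a"
    and \<beta> :: "'a \<Rightarrow> 'a"
    and scaleV :: "'k \<Rightarrow> 'v::ab_group_add \<Rightarrow> 'v"
    and Lprec :: "'a \<Rightarrow> 'v \<Rightarrow> 'v" (\<open>L\<^sub>\<prec>\<close>)
    and Rprec :: "'a \<Rightarrow> 'v \<Rightarrow> 'v" (\<open>R\<^sub>\<prec>\<close>)
    and Lsucc :: "'a \<Rightarrow> 'v \<Rightarrow> 'v" (\<open>L\<^sub>\<succ>\<close>)
    and Rsucc :: "'a \<Rightarrow> 'v \<Rightarrow> 'v" (\<open>R\<^sub>\<succ>\<close>) +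
  fixes \<phi> :: "'v \<Rightarrow> 'v"
    and \<psi> :: "'v \<Rightarrow> 'v"
  assumes linear_\<phi>: "Vector_Spaces.linear scaleV scaleV \<phi>"
    and linear_\<psi>: "Vector_Spaces.linear scaleV scaleV \<psi>"
    and \<phi>_\<psi>_commute: "\<phi> (\<psi> v) = \<psi> (\<phi> v)"
    and linear_actions: "F \<in> {L\<^sub>\<prec>, R\<^sub>\<prec>, L\<^sub>\<succ>, R\<^sub>\<succ>} \<Longrightarrow> linear_into_gl scaleA scaleV F"
    and \<phi>_action: "F \<in> {L\<^sub>\<prec>, R\<^sub>\<prec>, L\<^sub>\<succ>, R\<^sub>\<succ>} \<Longrightarrow> \<phi> (F x v) = F (\<alpha> x) (\<phi> v)"
    and \<psi>_action: "F \<in> {L\<^sub>\<prec>, R\<^sub>\<prec>, L\<^sub>\<succ>, R\<^sub>\<succ>} \<Longrightarrow> \<psi> (F x v) = F (\<beta> x) (\<psi> v)"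
    and bimodule_1:
      "L\<^sub>\<succ> (A.circ (\<beta> x) (\<alpha> x)) (\<psi> v) = L\<^sub>\<succ> (\<alpha> (\<beta> x)) (L\<^sub>\<succ> (\<alpha> x) v)"
    and bimodule_2:
      "R\<^sub>\<succ> (\<beta> y) (L\<^sub>\<odot> (\<beta> x) (\<phi> v) + R\<^sub>\<odot> (\<alpha> x) (\<psi> v)) =
         L\<^sub>\<succ> (\<alpha> (\<beta> x)) (R\<^sub>\<succ> y (\<phi> v)) + R\<^sub>\<succ> (\<alpha> x \<succ> y) (\<phi> (\<psi> v))"
    and bimodule_3:
      "R\<^sub>\<prec> (\<alpha> (\<beta> x)) (R\<^sub>\<prec> (\<beta> x) v) = R\<^sub>\<prec> (A.circ (\<beta> x) (\<alpha> x)) (\<phi> v)"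
    and bimodule_4:
      "L\<^sub>\<prec> (\<alpha> y) (L\<^sub>\<odot> (\<beta> x) (\<phi> v) + R\<^sub>\<odot> (\<alpha> x) (\<psi> v)) =
         L\<^sub>\<prec> (y \<prec> \<beta> x) (\<phi> (\<psi> v)) + R\<^sub>\<prec> (\<alpha> (\<beta> x)) (L\<^sub>\<prec> y (\<psi> v))"
    and bimodule_5:
      "L\<^sub>\<prec> (\<beta> x \<succ> \<alpha> y + \<beta> y \<prec> \<alpha> x) (\<psi> v) =
         L\<^sub>\<succ> (\<alpha> (\<beta> x)) (L\<^sub>\<prec> (\<alpha> y) v) + L\<^sub>\<prec> (\<alpha> (\<beta> y)) (L\<^sub>\<odot> (\<alpha> x) v)"
    and bimodule_6:
      "R\<^sub>\<prec> (\<beta> y) (L\<^sub>\<succ> (\<beta> x) (\<phi> v) + R\<^sub>\<prec> (\<alpha> x) (\<psi> v)) =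
         L\<^sub>\<succ> (\<alpha> (\<beta> x)) (R\<^sub>\<prec> y (\<phi> v)) + R\<^sub>\<prec> (A.circ (\<alpha> x) y) (\<phi> (\<psi> v))"
    and bimodule_7:
      "R\<^sub>\<prec> (\<beta> y) (R\<^sub>\<succ> (\<alpha> x) (\<psi> v) + L\<^sub>\<prec> (\<beta> x) (\<phi> v)) =
         R\<^sub>\<succ> (\<alpha> x \<prec> y) (\<phi> (\<psi> v)) + L\<^sub>\<prec> (\<alpha> (\<beta> x)) (R\<^sub>\<odot> y (\<phi> v))"
    and bimodule_8:
      "R\<^sub>\<prec> (\<alpha> (\<beta> y)) (R\<^sub>\<succ> (\<beta> x) v) + R\<^sub>\<succ> (\<alpha> (\<beta> x)) (R\<^sub>\<odot> (\<beta> y) v) =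
         R\<^sub>\<succ> (\<beta> x \<prec> \<alpha> y) (\<phi> v) + R\<^sub>\<succ> (\<beta> y \<succ> \<alpha> x) (\<phi> v)"
    and bimodule_9:
      "R\<^sub>\<prec> (\<alpha> (\<beta> y)) (L\<^sub>\<succ> x (\<psi> v)) + L\<^sub>\<succ> (A.circ x (\<beta> y)) (\<phi> (\<psi> v)) =
         L\<^sub>\<succ> (\<alpha> x) (R\<^sub>\<prec> (\<alpha> y) (\<psi> v) + L\<^sub>\<succ> (\<beta> y) (\<phi> v))"
    and bimodule_10:
      "L\<^sub>\<prec> (x \<succ> \<beta> y) (\<phi> (\<psi> v)) + R\<^sub>\<succ> (\<alpha> (\<beta> y)) (L\<^sub>\<odot> x (\<psi> v)) =
         L\<^sub>\<succ> (\<alpha> x) (L\<^sub>\<prec> (\<beta> y) (\<phi> v)) + L\<^sub>\<succ> (\<alpha> x) (R\<^sub>\<succ> (\<alpha> y) (\<psi> v))"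

locale bihom_O_operator =
  bihom_pre_alternative_bimodule scaleA prec succ \<alpha> \<beta> scaleV Lprec Rprec Lsucc Rsucc \<phi> \<psi>
  for scaleA :: "'k::field_char_0 \<Rightarrow> 'a::ab_group_add \<Rightarrow> 'a"
    and prec :: "'a \<Rightarrow> 'a \<Rightarrow> 'a" (infixl \<open>\<prec>\<close> 70)
    and succ :: "'a \<Rightarrow> 'a \<Rightarrow> 'a" (infixl \<open>\<succ>\<close> 70)
    and \<alpha> :: "'a \<Rightarrow> 'a"
    and \<beta> :: "'a \<Rightarrow> 'a"
    and scaleV :: "'k \<Rightarrow> 'v::ab_group_add \<Rightarrow> 'v"
    and Lprec :: "'a \<Rightarrow> 'v \<Rightarrow> 'v" (\<open>L\<^sub>\<prec>\<close>)
    and Rprec :: "'a \<Rightarrow> 'v \<Rightarrow> 'v" (\<open>R\<^sub>\<prec>\<close>)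
    and Lsucc :: "'a \<Rightarrow> 'v \<Rightarrow> 'v" (\<open>L\<^sub>\<succ>\<close>)
    and Rsucc :: "'a \<Rightarrow> 'v \<Rightarrow> 'v" (\<open>R\<^sub>\<succ>\<close>)
    and \<phi> :: "'v \<Rightarrow> 'v"
    and \<psi> :: "'v \<Rightarrow> 'v" +
  fixes T :: "'v \<Rightarrow> 'a"
  assumes linear_T: "Vector_Spaces.linear scaleV scaleA T"
    and T_\<phi>: "T (\<phi> v) = \<alpha> (T v)"
    and T_\<psi>: "T (\<psi> v) = \<beta> (T v)"
    and T_succ: "T u \<succ> T v = T (L\<^sub>\<succ> (T u) v + R\<^sub>\<succ> (T v) u)"
    and T_prec: "T u \<prec> T v = T (L\<^sub>\<prec> (T u) v + R\<^sub>\<prec> (T v) u)"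


section \<open>BiHom-alternative quadri-algebras\<close>

text \<open>
  The operations are named after the direction of their arrow: \<open>nw\<close> is the north-west arrow, and so
  on; \<open>vee\<close>, \<open>wedge\<close> and \<open>total\<close> are the sums usually written as a disjunction sign, a conjunction
  sign and an asterisk.
\<close>

locale quadri_ops =
  fixes nw :: "'a::ab_group_add \<Rightarrow> 'a \<Rightarrow> 'a"
    and sw :: "'a \<Rightarrow> 'a \<Rightarrow> 'a"
    and ne :: "'a \<Rightarrow> 'a \<Rightarrow> 'a"
    and se :: "'a \<Rightarrow> 'a \<Rightarrow> 'a"
    and \<alpha> :: "'a \<Rightarrow> 'a"
    and \<beta> :: "'a \<Rightarrow> 'a"
begin

definition hor_succ :: "'a \<Rightarrow> 'a \<Rightarrow> 'a" (infixl \<open>\<succ>\<close> 70)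
  where "x \<succ> y = ne x y + se x y"

definition hor_prec :: "'a \<Rightarrow> 'a \<Rightarrow> 'a" (infixl \<open>\<prec>\<close> 70)
  where "x \<prec> y = nw x y + sw x y"

definition vee :: "'a \<Rightarrow> 'a \<Rightarrow> 'a"
  where "vee x y = se x y + sw x y"

definition wedge :: "'a \<Rightarrow> 'a \<Rightarrow> 'a"
  where "wedge x y = ne x y + nw x y"

definition total :: "'a \<Rightarrow> 'a \<Rightarrow> 'a"
  where "total x y = se x y + ne x y + sw x y + nw x y"

definition br_r :: "'a \<Rightarrow> 'a \<Rightarrow> 'a \<Rightarrow> 'a"
  where "br_r x y z = nw (nw x y) (\<beta> z) - nw (\<alpha> x) (total y z)"

definition br_l :: "'a \<Rightarrow> 'a \<Rightarrow> 'a \<Rightarrow> 'a"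
  where "br_l x y z = se (total x y) (\<beta> z) - se (\<alpha> x) (se y z)"

definition br_ne :: "'a \<Rightarrow> 'a \<Rightarrow> 'a \<Rightarrow> 'a"
  where "br_ne x y z = ne (wedge x y) (\<beta> z) - ne (\<alpha> x) (y \<succ> z)"

definition br_sw :: "'a \<Rightarrow> 'a \<Rightarrow> 'a \<Rightarrow> 'a"
  where "br_sw x y z = sw (x \<prec> y) (\<beta> z) - sw (\<alpha> x) (vee y z)"

definition br_n :: "'a \<Rightarrow> 'a \<Rightarrow> 'a \<Rightarrow> 'a"
  where "br_n x y z = nw (ne x y) (\<beta> z) - ne (\<alpha> x) (y \<prec> z)"

definition br_w :: "'a \<Rightarrow> 'a \<Rightarrow> 'a \<Rightarrow> 'a"
  where "br_w x y z = nw (sw x y) (\<beta> z) - sw (\<alpha> x) (wedge y z)"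

definition br_s :: "'a \<Rightarrow> 'a \<Rightarrow> 'a \<Rightarrow> 'a"
  where "br_s x y z = sw (x \<succ> y) (\<beta> z) - se (\<alpha> x) (sw y z)"

definition br_e :: "'a \<Rightarrow> 'a \<Rightarrow> 'a \<Rightarrow> 'a"
  where "br_e x y z = ne (vee x y) (\<beta> z) - se (\<alpha> x) (ne y z)"

definition br_m :: "'a \<Rightarrow> 'a \<Rightarrow> 'a \<Rightarrow> 'a"
  where "br_m x y z = nw (se x y) (\<beta> z) - se (\<alpha> x) (nw y z)"

end

locale bihom_alternative_quadri =
  vector_space scale + quadri_ops nw sw ne se \<alpha> \<beta>
  for scale :: "'k::field_char_0 \<Rightarrow> 'a::ab_group_add \<Rightarrow> 'a"
    and S :: "'a set"
    and nw :: "'a \<Rightarrow> 'a \<Rightarrow> 'a"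
    and sw :: "'a \<Rightarrow> 'a \<Rightarrow> 'a"
    and ne :: "'a \<Rightarrow> 'a \<Rightarrow> 'a"
    and se :: "'a \<Rightarrow> 'a \<Rightarrow> 'a"
    and \<alpha> :: "'a \<Rightarrow> 'a"
    and \<beta> :: "'a \<Rightarrow> 'a" +
  assumes subspace_carrier: "subspace S"
    and bilinear_ops: "m \<in> {nw, sw, ne, se} \<Longrightarrow> bilinear_on scale S m"
    and linear_\<alpha>: "linear_on scale S scale S \<alpha>"
    and linear_\<beta>: "linear_on scale S scale S \<beta>"
    and \<alpha>_\<beta>_commute: "x \<in> S \<Longrightarrow> \<alpha> (\<beta> x) = \<beta> (\<alpha> x)"
    and \<alpha>_ops:
      "\<lbrakk>m \<in> {nw, sw, ne, se}; x \<in> S; y \<in> S\<rbrakk> \<Longrightarrow> \<alpha> (m x y) = m (\<alpha> x) (\<alpha> y)"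
    and \<beta>_ops:
      "\<lbrakk>m \<in> {nw, sw, ne, se}; x \<in> S; y \<in> S\<rbrakk> \<Longrightarrow> \<beta> (m x y) = m (\<beta> x) (\<beta> y)"
    and left_brackets:
      "\<lbrakk>(p, q) \<in> {(br_r, br_m), (br_n, br_w), (br_ne, br_e), (br_sw, br_s), (br_l, br_l)};
        x \<in> S; y \<in> S; z \<in> S\<rbrakk> \<Longrightarrow> p (\<beta> x) (\<alpha> y) z + q (\<beta> y) (\<alpha> x) z = 0"
    and right_brackets:
      "\<lbrakk>(p, q) \<in> {(br_r, br_r), (br_n, br_ne), (br_w, br_sw), (br_m, br_l), (br_s, br_e)};
        x \<in> S; y \<in> S; z \<in> S\<rbrakk> \<Longrightarrow> p x (\<beta> y) (\<alpha> z) + q x (\<beta> z) (\<alpha> y) = 0"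

text \<open>As for BiHom-pre-alternative algebras, only the conditions on the map are recorded.\<close>

definition bihom_alternative_quadri_hom ::
  "('k::field_char_0 \<Rightarrow> 'a::ab_group_add \<Rightarrow> 'a) \<Rightarrow> 'a set \<Rightarrow>
     ('a \<Rightarrow> 'a \<Rightarrow> 'a) \<Rightarrow> ('a \<Rightarrow> 'a \<Rightarrow> 'a) \<Rightarrow> ('a \<Rightarrow> 'a \<Rightarrow> 'a) \<Rightarrow> ('a \<Rightarrow> 'a \<Rightarrow> 'a) \<Rightarrow>
     ('a \<Rightarrow> 'a) \<Rightarrow> ('a \<Rightarrow> 'a) \<Rightarrow>
   ('k \<Rightarrow> 'b::ab_group_add \<Rightarrow> 'b) \<Rightarrow> 'b set \<Rightarrow>
     ('b \<Rightarrow> 'b \<Rightarrow> 'b) \<Rightarrow> ('b \<Rightarrow> 'b \<Rightarrow> 'b) \<Rightarrow> ('b \<Rightarrow> 'b \<Rightarrow> 'b) \<Rightarrow> ('b \<Rightarrow> 'b \<Rightarrow> 'b) \<Rightarrow>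
     ('b \<Rightarrow> 'b) \<Rightarrow> ('b \<Rightarrow> 'b) \<Rightarrow>
   ('a \<Rightarrow> 'b) \<Rightarrow> bool" where
  "bihom_alternative_quadri_hom s S nw sw ne se \<alpha> \<beta> s' S' nw' sw' ne' se' \<alpha>' \<beta>' f \<longleftrightarrow>
     linear_on s S s' S' f \<and>
     (\<forall>x\<in>S. \<forall>y\<in>S. f (nw x y) = nw' (f x) (f y)) \<and>
     (\<forall>x\<in>S. \<forall>y\<in>S. f (sw x y) = sw' (f x) (f y)) \<and>
     (\<forall>x\<in>S. \<forall>y\<in>S. f (ne x y) = ne' (f x) (f y)) \<and>
     (\<forall>x\<in>S. \<forall>y\<in>S. f (se x y) = se' (f x) (f y)) \<and>
     (\<forall>x\<in>S. f (\<alpha> x) = \<alpha>' (f x)) \<and>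
     (\<forall>x\<in>S. f (\<beta> x) = \<beta>' (f x))"

end

theory Submission
  imports Defs
begin

text \<open>
  Pulling the actions of \<open>A\<close> on \<open>V\<close> back along \<open>T\<close> turns the ten bimodule identities into the ten
  quadri-algebra identities.  The reason is that \<open>T\<close> carries \<open>\<nearrow> + \<searrow>\<close> to \<open>\<succ>\<close> and \<open>\<nwarrow> + \<swarrow>\<close> to \<open>\<prec>\<close>
  (this is what the \<open>\<O>\<close>-operator condition says) and intertwines the structure maps, so that for
  instance \<open>(u \<succ> v) \<swarrow> w\<close> is the action of \<open>T u \<succ> T v\<close> on \<open>w\<close>.  Eight of the identities arise by
  substitution (\<open>O_operator_mixed_brackets\<close>).  The other two, for \<open>(l, l)\<close> and \<open>(r, r)\<close>, are the
  polarised forms of the bimodule identities in which a single element of \<open>A\<close> acts twice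
  (\<open>L_succ_circ_polarised\<close>, \<open>R_prec_circ_polarised\<close>).

  In every quadri-algebra the nine brackets are the summands of the three associators of the
  horizontal operations (\<open>as_r_eq\<close>, \<open>as_m_eq\<close>, \<open>as_l_eq\<close>), so adding up the bracket identities shows
  that the horizontal operations are pre-alternative (\<open>horizontal_pre_alternative\<close>).

  The four operations descend to the range of \<open>T\<close>: the element \<open>T (u \<swarrow> v) = T (L\<^sub>\<prec> (T u) v)\<close>
  depends on \<open>u\<close> only through \<open>T u\<close>, and since it equals
  \<open>T u \<prec> T v - T (R\<^sub>\<prec> (T v) u)\<close>, it depends on \<open>v\<close> only through \<open>T v\<close>; the other arrows are
  similar (\<open>T_action_cong\<close>).  The identities then hold on the range since they pass to
  homomorphic images (\<open>bihom_alternative_quadri_image\<close>).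
\<close>

section \<open>Linearity\<close>

lemma linear_on_UNIV_iff:
  assumes "vector_space s1" "vector_space s2"
  shows "linear_on s1 UNIV s2 UNIV f \<longleftrightarrow> Vector_Spaces.linear s1 s2 f"
proof -
  interpret V1: vector_space s1 by fact
  interpret V2: vector_space s2 by fact
  show ?thesis
    unfolding linear_on_def linear_iff_module_hom module_hom_iff
    using V1.module_axioms V2.module_axioms by auto
qed

lemma linear_onI_image:
  assumes "linear_on s S s' S' f" and "linear_on s S s S g"
    and "\<And>x. x \<in> S \<Longrightarrow> g' (f x) = f (g x)"
    and "vector_space s" and "module.subspace s S"
  shows "linear_on s' (f ` S) s' (f ` S) g'"
proof -
  interpret vector_space s by fact
  have closed: "x + y \<in> S" "s c x \<in> S" if "x \<in> S" "y \<in> S" for x y c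
    using assms(5) that by (auto intro: subspace_add subspace_scale)
  have f: "f (x + y) = f x + f y" "f (s c x) = s' c (f x)" if "x \<in> S" "y \<in> S" for x y c
    using assms(1) that by (auto simp: linear_on_def)
  have g: "g x \<in> S" "g (x + y) = g x + g y" "g (s c x) = s c (g x)"
    if "x \<in> S" "y \<in> S" for x y c
    using assms(2) that by (auto simp: linear_on_def)
  show ?thesis
    unfolding linear_on_def
    by (auto simp: assms(3) f[symmetric] closed g)
qed

lemma bilinear_on_image:
  assumes f: "linear_on s S s' S' f" and m: "bilinear_on s S m"
    and eq: "\<And>x y. x \<in> S \<Longrightarrow> y \<in> S \<Longrightarrow> m' (f x) (f y) = f (m x y)"
    and S: "vector_space s" "module.subspace s S"
  shows "bilinear_on s' (f ` S) m'"
  unfolding bilinear_on_def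
proof safe
  fix x assume x: "x \<in> S"
  show "linear_on s' (f ` S) s' (f ` S) (m' (f x))"
    by (rule linear_onI_image[OF f, of "m x"]) (use m x eq S in \<open>auto simp: bilinear_on_def\<close>)
  show "linear_on s' (f ` S) s' (f ` S) (\<lambda>y. m' y (f x))"
    by (rule linear_onI_image[OF f, of "\<lambda>y. m y x"]) (use m x eq S in \<open>auto simp: bilinear_on_def\<close>)
qed

section \<open>The horizontal algebra of a quadri-algebra\<close>

context bihom_alternative_quadri
begin

lemma op_closed: "\<lbrakk>m \<in> {nw, sw, ne, se}; x \<in> S; y \<in> S\<rbrakk> \<Longrightarrow> m x y \<in> S"
  and op_add_right:
    "\<lbrakk>m \<in> {nw, sw, ne, se}; x \<in> S; y \<in> S; z \<in> S\<rbrakk> \<Longrightarrow> m x (y + z) = m x y + m x z"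
  and op_add_left:
    "\<lbrakk>m \<in> {nw, sw, ne, se}; x \<in> S; y \<in> S; z \<in> S\<rbrakk> \<Longrightarrow> m (x + y) z = m x z + m y z"
  using bilinear_ops[of m] by (auto simp: bilinear_on_def linear_on_def)

lemmas ops_closed = op_closed[of nw] op_closed[of sw] op_closed[of ne] op_closed[of se]
lemmas ops_add =
  op_add_right[of nw] op_add_right[of sw] op_add_right[of ne] op_add_right[of se]
  op_add_left[of nw] op_add_left[of sw] op_add_left[of ne] op_add_left[of se]

lemma structure_map_closed: "x \<in> S \<Longrightarrow> \<alpha> x \<in> S" "x \<in> S \<Longrightarrow> \<beta> x \<in> S"
  using linear_\<alpha> linear_\<beta> by (auto simp: linear_on_def)

lemma structure_map_add:
  "\<lbrakk>x \<in> S; y \<in> S\<rbrakk> \<Longrightarrow> \<alpha> (x + y) = \<alpha> x + \<alpha> y"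
  "\<lbrakk>x \<in> S; y \<in> S\<rbrakk> \<Longrightarrow> \<beta> (x + y) = \<beta> x + \<beta> y"
  using linear_\<alpha> linear_\<beta> by (auto simp: linear_on_def)

lemma carrier_add: "\<lbrakk>x \<in> S; y \<in> S\<rbrakk> \<Longrightarrow> x + y \<in> S"
  using subspace_carrier by (rule subspace_add)

lemmas carrier_closed = ops_closed structure_map_closed carrier_add

lemma bilinear_on_sum:
  assumes "m \<in> {nw, sw, ne, se}" "n \<in> {nw, sw, ne, se}"
  shows "bilinear_on scale S (\<lambda>x y. m x y + n x y)"
proof -
  have "bilinear_on scale S m" "bilinear_on scale S n"
    using assms by (auto intro: bilinear_ops)
  then show ?thesis
    by (simp add: bilinear_on_def linear_on_def carrier_add scale_right_distrib)
qed

sublocale horizontal: pre_alternative_ops hor_prec hor_succ \<alpha> \<beta> .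

text \<open>
  Both sides expand to the same compositions of two arrows.  In \<open>as_r x y z\<close>, for example,
  \<open>(x \<prec> y) \<nwarrow> \<beta> z\<close> splits into \<open>(x \<nwarrow> y) \<nwarrow> \<beta> z\<close> and \<open>(x \<swarrow> y) \<nwarrow> \<beta> z\<close>, which start \<open>br_r\<close> and
  \<open>br_w\<close>, whereas \<open>(x \<prec> y) \<swarrow> \<beta> z\<close> starts \<open>br_sw\<close> as a whole.  Accordingly the sum of the four
  products of \<open>y\<close> and \<open>z\<close> is kept together to the right of \<open>\<alpha> x \<nwarrow>\<close>, but is regrouped as
  \<open>vee y z + wedge y z\<close> to the right of \<open>\<alpha> x \<swarrow>\<close>.
\<close>

lemma as_r_eq:
  assumes "x \<in> S" "y \<in> S" "z \<in> S"
  shows "horizontal.as_r x y z = br_r x y z + br_w x y z + br_sw x y z"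
  using assms
  by (simp add: horizontal.as_r_def horizontal.circ_def br_r_def br_w_def br_sw_def hor_prec_def
      hor_succ_def vee_def wedge_def total_def ops_add carrier_closed algebra_simps)

lemma as_m_eq:
  assumes "x \<in> S" "y \<in> S" "z \<in> S"
  shows "horizontal.as_m x y z = br_n x y z + br_m x y z + br_s x y z"
  using assms
  by (simp add: horizontal.as_m_def br_n_def br_m_def br_s_def hor_prec_def
      hor_succ_def ops_add carrier_closed algebra_simps)

lemma as_l_eq:
  assumes "x \<in> S" "y \<in> S" "z \<in> S"
  shows "horizontal.as_l x y z = br_ne x y z + br_e x y z + br_l x y z"
  using assms
  by (simp add: horizontal.as_l_def horizontal.circ_def br_ne_def br_e_def br_l_def hor_prec_def
      hor_succ_def vee_def wedge_def total_def ops_add carrier_closed algebra_simps)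

lemma horizontal_pre_alternative: "bihom_pre_alternative scale S hor_prec hor_succ \<alpha> \<beta>"
proof
  show "bilinear_on scale S hor_prec"
    unfolding hor_prec_def by (rule bilinear_on_sum) auto
  show "bilinear_on scale S hor_succ"
    unfolding hor_succ_def by (rule bilinear_on_sum) auto
  fix x y assume "x \<in> S" "y \<in> S"
  then show "\<alpha> (hor_prec x y) = hor_prec (\<alpha> x) (\<alpha> y)" "\<beta> (hor_prec x y) = hor_prec (\<beta> x) (\<beta> y)"
    "\<alpha> (hor_succ x y) = hor_succ (\<alpha> x) (\<alpha> y)" "\<beta> (hor_succ x y) = hor_succ (\<beta> x) (\<beta> y)"
    by (simp_all add: hor_prec_def hor_succ_def structure_map_add carrier_closed \<alpha>_ops \<beta>_ops)
next
  fix x y z assume S: "x \<in> S" "y \<in> S" "z \<in> S"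
  note closed = S carrier_closed
  have cancel: "(a + b + c) + (a' + b' + c') = 0"
    if "a + a' = 0" "b + b' = 0" "c + c' = 0" for a b c a' b' c' :: 'a
    using that by (metis add.assoc add.commute add.right_neutral)
  show "horizontal.as_r x (\<beta> y) (\<alpha> z) + horizontal.as_r x (\<beta> z) (\<alpha> y) = 0"
  proof -
    \<comment> \<open>The \<open>(w, sw)\<close> identity is used twice, the second time with \<open>y\<close> and \<open>z\<close> exchanged.\<close>
    have "br_r x (\<beta> y) (\<alpha> z) + br_r x (\<beta> z) (\<alpha> y) = 0"
      "br_w x (\<beta> y) (\<alpha> z) + br_sw x (\<beta> z) (\<alpha> y) = 0"
      "br_sw x (\<beta> y) (\<alpha> z) + br_w x (\<beta> z) (\<alpha> y) = 0"
      using right_brackets[of br_r br_r x y z] right_brackets[of br_w br_sw x y z]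
        right_brackets[of br_w br_sw x z y] S by (auto simp: add.commute)
    from cancel[OF this] show ?thesis
      by (simp add: as_r_eq closed algebra_simps)
  qed
  show "horizontal.as_l (\<beta> x) (\<alpha> y) z + horizontal.as_l (\<beta> y) (\<alpha> x) z = 0"
  proof -
    have "br_ne (\<beta> x) (\<alpha> y) z + br_e (\<beta> y) (\<alpha> x) z = 0"
      "br_e (\<beta> x) (\<alpha> y) z + br_ne (\<beta> y) (\<alpha> x) z = 0"
      "br_l (\<beta> x) (\<alpha> y) z + br_l (\<beta> y) (\<alpha> x) z = 0"
      using left_brackets[of br_ne br_e x y z] left_brackets[of br_ne br_e y x z]
        left_brackets[of br_l br_l x y z] S by (auto simp: add.commute)
    from cancel[OF this] show ?thesis
      by (simp add: as_l_eq closed algebra_simps)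
  qed
  show "horizontal.as_m (\<beta> x) (\<alpha> y) z + horizontal.as_r (\<beta> y) (\<alpha> x) z = 0"
  proof -
    have "br_n (\<beta> x) (\<alpha> y) z + br_w (\<beta> y) (\<alpha> x) z = 0"
      "br_m (\<beta> x) (\<alpha> y) z + br_r (\<beta> y) (\<alpha> x) z = 0"
      "br_s (\<beta> x) (\<alpha> y) z + br_sw (\<beta> y) (\<alpha> x) z = 0"
      using left_brackets[of br_n br_w x y z] left_brackets[of br_r br_m y x z]
        left_brackets[of br_sw br_s y x z] S by (auto simp: add.commute)
    from cancel[OF this] show ?thesis
      by (simp add: as_m_eq as_r_eq closed algebra_simps)
  qed
  show "horizontal.as_m x (\<beta> y) (\<alpha> z) + horizontal.as_l x (\<beta> z) (\<alpha> y) = 0"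
  proof -
    have "br_n x (\<beta> y) (\<alpha> z) + br_ne x (\<beta> z) (\<alpha> y) = 0"
      "br_m x (\<beta> y) (\<alpha> z) + br_l x (\<beta> z) (\<alpha> y) = 0"
      "br_s x (\<beta> y) (\<alpha> z) + br_e x (\<beta> z) (\<alpha> y) = 0"
      using right_brackets[of br_n br_ne x y z] right_brackets[of br_m br_l x y z]
        right_brackets[of br_s br_e x y z] S by auto
    from cancel[OF this] show ?thesis
      by (simp add: as_m_eq as_l_eq closed algebra_simps)
  qed
qed (simp_all add: subspace_carrier linear_\<alpha> linear_\<beta> \<alpha>_\<beta>_commute)

end

section \<open>Homomorphic images of quadri-algebras\<close>

text \<open>
  On the image, every bracket of \<open>f u\<close>, \<open>f v\<close>, \<open>f w\<close> is the value of \<open>f\<close> at the bracket of \<open>u\<close>,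
  \<open>v\<close>, \<open>w\<close>; all axioms are therefore inherited.
\<close>

lemma bihom_alternative_quadri_image:
  assumes quadri: "bihom_alternative_quadri s S nw sw ne se \<alpha> \<beta>"
    and space: "vector_space s'"
    and hom: "bihom_alternative_quadri_hom s S nw sw ne se \<alpha> \<beta>
                s' S' nw' sw' ne' se' \<alpha>' \<beta>' f"
  shows "bihom_alternative_quadri s' (f ` S) nw' sw' ne' se' \<alpha>' \<beta>'"
proof -
  interpret Q: bihom_alternative_quadri s S nw sw ne se \<alpha> \<beta> by fact
  interpret Q': vector_space s' by fact
  interpret Q': quadri_ops nw' sw' ne' se' \<alpha>' \<beta>' .
  have lin: "linear_on s S s' S' f"
    using hom by (simp add: bihom_alternative_quadri_hom_def)
  have f_add: "f x + f y = f (x + y)" and f_scale: "s' c (f x) = f (s c x)"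
    if "x \<in> S" "y \<in> S" for x y c
    using lin that by (auto simp: linear_on_def)
  have f_diff: "f x - f y = f (x - y)" if "x \<in> S" "y \<in> S" for x y
    using f_add[of "x - y" y] Q.subspace_diff[OF Q.subspace_carrier that] that
    by (simp add: diff_eq_eq)
  have f_ops: "nw' (f x) (f y) = f (nw x y)" "sw' (f x) (f y) = f (sw x y)"
    "ne' (f x) (f y) = f (ne x y)" "se' (f x) (f y) = f (se x y)"
    if "x \<in> S" "y \<in> S" for x y
    using hom that by (simp_all add: bihom_alternative_quadri_hom_def)
  have f_maps: "\<alpha>' (f x) = f (\<alpha> x)" "\<beta>' (f x) = f (\<beta> x)" if "x \<in> S" for x
    using hom that by (simp_all add: bihom_alternative_quadri_hom_def)
  have f_zero: "f 0 = 0"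
    using f_add[of 0 0] Q.subspace_0[OF Q.subspace_carrier] by simp
  \<comment> \<open>These equations are oriented so as to pull \<open>f\<close> outwards until it is the head of the term.\<close>
  note transport = f_add f_diff f_ops f_maps Q.carrier_closed
  have f_brackets: "Q'.br_r (f x) (f y) (f z) = f (Q.br_r x y z)"
    "Q'.br_l (f x) (f y) (f z) = f (Q.br_l x y z)"
    "Q'.br_ne (f x) (f y) (f z) = f (Q.br_ne x y z)"
    "Q'.br_sw (f x) (f y) (f z) = f (Q.br_sw x y z)"
    "Q'.br_n (f x) (f y) (f z) = f (Q.br_n x y z)"
    "Q'.br_w (f x) (f y) (f z) = f (Q.br_w x y z)"
    "Q'.br_s (f x) (f y) (f z) = f (Q.br_s x y z)"
    "Q'.br_e (f x) (f y) (f z) = f (Q.br_e x y z)"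
    "Q'.br_m (f x) (f y) (f z) = f (Q.br_m x y z)"
    if "x \<in> S" "y \<in> S" "z \<in> S" for x y z
    using that
    by (simp_all add: transport
        Q.br_r_def Q.br_l_def Q.br_ne_def Q.br_sw_def Q.br_n_def Q.br_w_def Q.br_s_def Q.br_e_def
        Q.br_m_def Q.hor_prec_def Q.hor_succ_def Q.vee_def Q.wedge_def Q.total_def
        Q'.br_r_def Q'.br_l_def Q'.br_ne_def Q'.br_sw_def Q'.br_n_def Q'.br_w_def Q'.br_s_def
        Q'.br_e_def Q'.br_m_def Q'.hor_prec_def Q'.hor_succ_def Q'.vee_def Q'.wedge_def
        Q'.total_def)
  have br_closed: "p x y z \<in> S"
    if "p \<in> {Q.br_r, Q.br_l, Q.br_ne, Q.br_sw, Q.br_n, Q.br_w, Q.br_s, Q.br_e, Q.br_m}"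
      "x \<in> S" "y \<in> S" "z \<in> S" for p x y z
    using that
    by (auto simp: Q.br_r_def Q.br_l_def Q.br_ne_def Q.br_sw_def Q.br_n_def Q.br_w_def Q.br_s_def
        Q.br_e_def Q.br_m_def Q.hor_prec_def Q.hor_succ_def Q.vee_def Q.wedge_def Q.total_def
        intro!: Q.subspace_diff[OF Q.subspace_carrier] Q.carrier_closed)
  have identity: "f a + f b = 0" if "a \<in> S" "b \<in> S" "a + b = 0" for a b
    using that f_zero by (simp add: f_add)
  have left: "f (p (\<beta> x) (\<alpha> y) z) + f (q (\<beta> y) (\<alpha> x) z) = 0"
    if pq: "(p, q) \<in> {(Q.br_r, Q.br_m), (Q.br_n, Q.br_w), (Q.br_ne, Q.br_e),
      (Q.br_sw, Q.br_s), (Q.br_l, Q.br_l)}" and S: "x \<in> S" "y \<in> S" "z \<in> S" for p q x y z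
    by (rule identity[OF br_closed[of p] br_closed[of q] Q.left_brackets[OF pq S]])
      (use pq S Q.structure_map_closed in auto)
  have right: "f (p x (\<beta> y) (\<alpha> z)) + f (q x (\<beta> z) (\<alpha> y)) = 0"
    if pq: "(p, q) \<in> {(Q.br_r, Q.br_r), (Q.br_n, Q.br_ne), (Q.br_w, Q.br_sw),
      (Q.br_m, Q.br_l), (Q.br_s, Q.br_e)}" and S: "x \<in> S" "y \<in> S" "z \<in> S" for p q x y z
    by (rule identity[OF br_closed[of p] br_closed[of q] Q.right_brackets[OF pq S]])
      (use pq S Q.structure_map_closed in auto)
  show ?thesis
  proof
    show "Q'.subspace (f ` S)"
    proof (rule Q'.subspaceI)
      show "0 \<in> f ` S"
        using f_zero Q.subspace_0[OF Q.subspace_carrier] by (metis imageI)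
    qed (auto simp: f_add f_scale Q.carrier_add Q.subspace_scale[OF Q.subspace_carrier])
    fix m assume "m \<in> {nw', sw', ne', se'}"
    then show "bilinear_on s' (f ` S) m"
      by (elim insertE emptyE; hypsubst)
        (rule bilinear_on_image[OF lin Q.bilinear_ops _ Q.vector_space_axioms Q.subspace_carrier];
          use f_ops in simp)+
    fix x y assume "x \<in> f ` S" "y \<in> f ` S"
    with \<open>m \<in> {nw', sw', ne', se'}\<close>
    show "\<alpha>' (m x y) = m (\<alpha>' x) (\<alpha>' y)" "\<beta>' (m x y) = m (\<beta>' x) (\<beta>' y)"
      by (auto simp: transport Q.\<alpha>_ops[of nw] Q.\<alpha>_ops[of sw] Q.\<alpha>_ops[of ne]
          Q.\<alpha>_ops[of se] Q.\<beta>_ops[of nw] Q.\<beta>_ops[of sw] Q.\<beta>_ops[of ne] Q.\<beta>_ops[of se])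
  next
    show "linear_on s' (f ` S) s' (f ` S) \<alpha>'" "linear_on s' (f ` S) s' (f ` S) \<beta>'"
      using linear_onI_image[OF lin Q.linear_\<alpha>, of \<alpha>'] linear_onI_image[OF lin Q.linear_\<beta>, of \<beta>']
      by (simp_all add: f_maps Q.vector_space_axioms Q.subspace_carrier)
  next
    fix x assume "x \<in> f ` S"
    then show "\<alpha>' (\<beta>' x) = \<beta>' (\<alpha>' x)"
      by (auto simp: transport Q.\<alpha>_\<beta>_commute)
  next
    fix p q x y z
    assume "(p, q) \<in> {(Q'.br_r, Q'.br_m), (Q'.br_n, Q'.br_w), (Q'.br_ne, Q'.br_e),
        (Q'.br_sw, Q'.br_s), (Q'.br_l, Q'.br_l)}"
      and "x \<in> f ` S" "y \<in> f ` S" "z \<in> f ` S"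
    then show "p (\<beta>' x) (\<alpha>' y) z + q (\<beta>' y) (\<alpha>' x) z = 0"
      by (auto simp: f_maps f_brackets Q.structure_map_closed
          left[of Q.br_r Q.br_m] left[of Q.br_n Q.br_w] left[of Q.br_ne Q.br_e]
          left[of Q.br_sw Q.br_s] left[of Q.br_l Q.br_l])
  next
    fix p q x y z
    assume "(p, q) \<in> {(Q'.br_r, Q'.br_r), (Q'.br_n, Q'.br_ne), (Q'.br_w, Q'.br_sw),
        (Q'.br_m, Q'.br_l), (Q'.br_s, Q'.br_e)}"
      and "x \<in> f ` S" "y \<in> f ` S" "z \<in> f ` S"
    then show "p x (\<beta>' y) (\<alpha>' z) + q x (\<beta>' z) (\<alpha>' y) = 0"
      by (auto simp: f_maps f_brackets Q.structure_map_closed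
          right[of Q.br_r Q.br_r] right[of Q.br_n Q.br_ne] right[of Q.br_w Q.br_sw]
          right[of Q.br_m Q.br_l] right[of Q.br_s Q.br_e])
  qed
qed

section \<open>The quadri-algebra of an O-operator\<close>

context bihom_pre_alternative_bimodule
begin

lemma action_linear_vector:
  "F \<in> {L\<^sub>\<prec>, R\<^sub>\<prec>, L\<^sub>\<succ>, R\<^sub>\<succ>} \<Longrightarrow> Vector_Spaces.linear scaleV scaleV (F x)"
  and action_linear_element:
  "F \<in> {L\<^sub>\<prec>, R\<^sub>\<prec>, L\<^sub>\<succ>, R\<^sub>\<succ>} \<Longrightarrow> Vector_Spaces.linear scaleA scaleV (\<lambda>x. F x v)"
  using linear_actions[of F] by (auto simp: linear_into_gl_def)

lemma action_add_vector: "F \<in> {L\<^sub>\<prec>, R\<^sub>\<prec>, L\<^sub>\<succ>, R\<^sub>\<succ>} \<Longrightarrow> F x (v + w) = F x v + F x w"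
  and action_add_element: "F \<in> {L\<^sub>\<prec>, R\<^sub>\<prec>, L\<^sub>\<succ>, R\<^sub>\<succ>} \<Longrightarrow> F (x + y) v = F x v + F y v"
  using action_linear_vector[of F x] action_linear_element[of F v]
  by (auto simp: linear_iff_module_hom module_hom_iff)

lemmas actions_add =
  action_add_vector[of "L\<^sub>\<prec>"] action_add_vector[of "R\<^sub>\<prec>"]
  action_add_vector[of "L\<^sub>\<succ>"] action_add_vector[of "R\<^sub>\<succ>"]
  action_add_element[of "L\<^sub>\<prec>"] action_add_element[of "R\<^sub>\<prec>"]
  action_add_element[of "L\<^sub>\<succ>"] action_add_element[of "R\<^sub>\<succ>"]

lemma \<alpha>_add: "\<alpha> (x + y) = \<alpha> x + \<alpha> y" and \<beta>_add: "\<beta> (x + y) = \<beta> x + \<beta> y"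
  using A.linear_\<alpha> A.linear_\<beta> by (auto simp: linear_on_def)

lemma circ_add:
  "A.circ (x + y) z = A.circ x z + A.circ y z" "A.circ x (y + z) = A.circ x y + A.circ x z"
  using A.bilinear_prec A.bilinear_succ
  by (auto simp: A.circ_def bilinear_on_def linear_on_def)

text \<open>
  Both sides of \<open>bimodule_1\<close> and of \<open>bimodule_3\<close> are quadratic in the element of \<open>A\<close>:
  at \<open>x + y\<close> the identities for \<open>x\<close> and for \<open>y\<close> cancel and the mixed terms remain.
\<close>

lemma L_succ_circ_polarised:
  "L\<^sub>\<succ> (A.circ (\<beta> x) (\<alpha> y)) (\<psi> v) + L\<^sub>\<succ> (A.circ (\<beta> y) (\<alpha> x)) (\<psi> v) =
   L\<^sub>\<succ> (\<alpha> (\<beta> x)) (L\<^sub>\<succ> (\<alpha> y) v) + L\<^sub>\<succ> (\<alpha> (\<beta> y)) (L\<^sub>\<succ> (\<alpha> x) v)"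
  using bimodule_1[of "x + y" v] bimodule_1[of x v] bimodule_1[of y v]
  by (simp add: \<alpha>_add \<beta>_add circ_add actions_add algebra_simps)

lemma R_prec_circ_polarised:
  "R\<^sub>\<prec> (\<alpha> (\<beta> x)) (R\<^sub>\<prec> (\<beta> y) v) + R\<^sub>\<prec> (\<alpha> (\<beta> y)) (R\<^sub>\<prec> (\<beta> x) v) =
   R\<^sub>\<prec> (A.circ (\<beta> x) (\<alpha> y)) (\<phi> v) + R\<^sub>\<prec> (A.circ (\<beta> y) (\<alpha> x)) (\<phi> v)"
  using bimodule_3[of "x + y" v] bimodule_3[of x v] bimodule_3[of y v]
  by (simp add: \<alpha>_add \<beta>_add circ_add actions_add algebra_simps)

end

context bihom_O_operator
begin

abbreviation nw :: "'v \<Rightarrow> 'v \<Rightarrow> 'v" where "nw \<equiv> \<lambda>u v. R\<^sub>\<prec> (T v) u"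
abbreviation sw :: "'v \<Rightarrow> 'v \<Rightarrow> 'v" where "sw \<equiv> \<lambda>u v. L\<^sub>\<prec> (T u) v"
abbreviation ne :: "'v \<Rightarrow> 'v \<Rightarrow> 'v" where "ne \<equiv> \<lambda>u v. R\<^sub>\<succ> (T v) u"
abbreviation se :: "'v \<Rightarrow> 'v \<Rightarrow> 'v" where "se \<equiv> \<lambda>u v. L\<^sub>\<succ> (T u) v"

sublocale Q: quadri_ops nw sw ne se \<phi> \<psi> .

lemma T_add: "T (u + v) = T u + T v" and T_scale: "T (scaleV c u) = scaleA c (T u)"
  using linear_T by (auto simp: linear_iff_module_hom module_hom_iff)

lemma T_hor_succ: "T (Q.hor_succ u v) = T u \<succ> T v"
  and T_hor_prec: "T (Q.hor_prec u v) = T u \<prec> T v"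
  by (simp_all add: Q.hor_succ_def Q.hor_prec_def T_succ T_prec add.commute)

lemma T_total: "T (Q.total u v) = A.circ (T u) (T v)"
  by (simp add: Q.total_def A.circ_def T_succ T_prec T_add add_ac)

text \<open>
  Each product has the form \<open>F (T u) v\<close> or \<open>F (T v) u\<close>, so one of its arguments enters through its
  image under \<open>T\<close> by definition.  After applying \<open>T\<close> the same is true of the other argument,
  because the product is then \<open>T u \<prec> T v\<close> (or \<open>T u \<succ> T v\<close>) minus the companion product, in
  which the two arguments have exchanged their roles.
\<close>

lemma T_action_cong:
  assumes "T u = T u'" "T v = T v'"
  shows "T (nw u v) = T (nw u' v')" "T (sw u v) = T (sw u' v')"
    "T (ne u v) = T (ne u' v')" "T (se u v) = T (se u' v')"
proof -
  have companion: "T (nw u v) = T u \<prec> T v - T (sw u v)" "T (sw u v) = T u \<prec> T v - T (nw u v)"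
    "T (ne u v) = T u \<succ> T v - T (se u v)" "T (se u v) = T u \<succ> T v - T (ne u v)" for u v
    by (simp_all add: T_prec T_succ T_add)
  show "T (nw u v) = T (nw u' v')"
    using assms by (metis companion(1))
  show "T (sw u v) = T (sw u' v')"
    using assms by (metis companion(2))
  show "T (ne u v) = T (ne u' v')"
    using assms by (metis companion(3))
  show "T (se u v) = T (se u' v')"
    using assms by (metis companion(4))
qed

lemmas bracket_defs = Q.br_r_def Q.br_l_def Q.br_ne_def Q.br_sw_def Q.br_n_def Q.br_w_def
  Q.br_s_def Q.br_e_def Q.br_m_def

lemma polarised_brackets:
  "Q.br_l (\<psi> u) (\<phi> v) w + Q.br_l (\<psi> v) (\<phi> u) w = 0"
  "Q.br_r u (\<psi> v) (\<phi> w) + Q.br_r u (\<psi> w) (\<phi> v) = 0"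
  using L_succ_circ_polarised[of "T u" "T v" w] R_prec_circ_polarised[of "T v" "T w" u]
  by (simp_all add: bracket_defs T_total T_\<phi> T_\<psi> A.\<alpha>_\<beta>_commute \<phi>_\<psi>_commute algebra_simps)

text \<open>
  In each identity one of \<open>u\<close>, \<open>v\<close>, \<open>w\<close> is acted upon and the other two act through \<open>T\<close>.  If the
  vector acted upon stands under \<open>\<psi>\<close> in one bracket, it stands under \<open>\<phi>\<close> in the other, which is
  the pattern of the bimodule identity that is substituted.  The sums \<open>L\<^sub>\<odot>\<close> and \<open>R\<^sub>\<odot>\<close> come from
  \<open>vee u v = L\<^sub>\<odot> (T u) v\<close> and \<open>wedge u v = R\<^sub>\<odot> (T v) u\<close>.
\<close>

lemma O_operator_mixed_brackets:
  "Q.br_r (\<psi> u) (\<phi> v) w + Q.br_m (\<psi> v) (\<phi> u) w = 0"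
  "Q.br_n (\<psi> u) (\<phi> v) w + Q.br_w (\<psi> v) (\<phi> u) w = 0"
  "Q.br_ne (\<psi> u) (\<phi> v) w + Q.br_e (\<psi> v) (\<phi> u) w = 0"
  "Q.br_sw (\<psi> u) (\<phi> v) w + Q.br_s (\<psi> v) (\<phi> u) w = 0"
  "Q.br_n u (\<psi> v) (\<phi> w) + Q.br_ne u (\<psi> w) (\<phi> v) = 0"
  "Q.br_w u (\<psi> v) (\<phi> w) + Q.br_sw u (\<psi> w) (\<phi> v) = 0"
  "Q.br_m u (\<psi> v) (\<phi> w) + Q.br_l u (\<psi> w) (\<phi> v) = 0"
  "Q.br_s u (\<psi> v) (\<phi> w) + Q.br_e u (\<psi> w) (\<phi> v) = 0"
proof -
  note normalise = bracket_defs T_total T_hor_prec T_hor_succ T_\<phi> T_\<psi> Q.vee_def Q.wedge_def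
    Lcirc_def Rcirc_def actions_add A.\<alpha>_\<beta>_commute \<phi>_\<psi>_commute algebra_simps
  show "Q.br_r (\<psi> u) (\<phi> v) w + Q.br_m (\<psi> v) (\<phi> u) w = 0"
    using bimodule_6[of "T w" "T v" u] by (simp add: normalise)
  show "Q.br_n (\<psi> u) (\<phi> v) w + Q.br_w (\<psi> v) (\<phi> u) w = 0"
    using bimodule_7[of "T w" "T v" u] by (simp add: normalise)
  show "Q.br_ne (\<psi> u) (\<phi> v) w + Q.br_e (\<psi> v) (\<phi> u) w = 0"
    using bimodule_2[of "T w" "T v" u] by (simp add: normalise)
  show "Q.br_sw (\<psi> u) (\<phi> v) w + Q.br_s (\<psi> v) (\<phi> u) w = 0"
    using bimodule_5[of "T v" "T u" w] by (simp add: normalise)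
  show "Q.br_n u (\<psi> v) (\<phi> w) + Q.br_ne u (\<psi> w) (\<phi> v) = 0"
    using bimodule_8[of "T w" "T v" u] by (simp add: normalise)
  show "Q.br_w u (\<psi> v) (\<phi> w) + Q.br_sw u (\<psi> w) (\<phi> v) = 0"
    using bimodule_4[of "T u" "T w" v] by (simp add: normalise)
  show "Q.br_m u (\<psi> v) (\<phi> w) + Q.br_l u (\<psi> w) (\<phi> v) = 0"
    using bimodule_9[of "T w" "T u" v] by (simp add: normalise)
  show "Q.br_s u (\<psi> v) (\<phi> w) + Q.br_e u (\<psi> w) (\<phi> v) = 0"
    using bimodule_10[of "T u" "T v" w] by (simp add: normalise)
qed

lemma bilinear_left_action:
  assumes "F \<in> {L\<^sub>\<prec>, R\<^sub>\<prec>, L\<^sub>\<succ>, R\<^sub>\<succ>}"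
  shows "bilinear_on scaleV UNIV (\<lambda>u v. F (T u) v)"
  using Vector_Spaces.linear_compose[OF linear_T action_linear_element[OF assms]]
    action_linear_vector[OF assms]
  by (simp add: bilinear_on_def linear_on_UNIV_iff V.vector_space_axioms o_def)

lemma bilinear_right_action:
  assumes "F \<in> {L\<^sub>\<prec>, R\<^sub>\<prec>, L\<^sub>\<succ>, R\<^sub>\<succ>}"
  shows "bilinear_on scaleV UNIV (\<lambda>u v. F (T v) u)"
  using bilinear_left_action[OF assms] by (simp add: bilinear_on_def)

lemma O_operator_quadri: "bihom_alternative_quadri scaleV UNIV nw sw ne se \<phi> \<psi>"
proof
  fix m assume m: "m \<in> {nw, sw, ne, se}"
  then show "bilinear_on scaleV UNIV m"
    by (auto intro: bilinear_left_action bilinear_right_action)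
  show "\<phi> (m x y) = m (\<phi> x) (\<phi> y)" "\<psi> (m x y) = m (\<psi> x) (\<psi> y)" for x y
    using m by (auto simp: T_\<phi> T_\<psi> \<phi>_action \<psi>_action)
next
  fix p q u v w
  show "p (\<psi> u) (\<phi> v) w + q (\<psi> v) (\<phi> u) w = 0"
    if "(p, q) \<in> {(Q.br_r, Q.br_m), (Q.br_n, Q.br_w), (Q.br_ne, Q.br_e),
      (Q.br_sw, Q.br_s), (Q.br_l, Q.br_l)}"
    using that
    by (auto simp: O_operator_mixed_brackets polarised_brackets)
  show "p u (\<psi> v) (\<phi> w) + q u (\<psi> w) (\<phi> v) = 0"
    if "(p, q) \<in> {(Q.br_r, Q.br_r), (Q.br_n, Q.br_ne), (Q.br_w, Q.br_sw),
      (Q.br_m, Q.br_l), (Q.br_s, Q.br_e)}"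
    using that
    by (auto simp: O_operator_mixed_brackets polarised_brackets)
qed (simp_all add: linear_on_UNIV_iff V.vector_space_axioms linear_\<phi> linear_\<psi> \<phi>_\<psi>_commute)

lemma range_T_subalgebra:
  "bihom_pre_alternative_subalgebra scaleA UNIV (\<prec>) (\<succ>) \<alpha> \<beta> (range T)"
proof -
  have "A.subspace (range T)"
    using linear_T A.vector_space_axioms V.vector_space_axioms
    by (metis V.subspace_UNIV linear_iff_module_hom module_hom.subspace_image)
  then show ?thesis
    by (auto simp: bihom_pre_alternative_subalgebra_def T_prec T_succ T_\<phi>[symmetric]
        T_\<psi>[symmetric])
qed

end

section \<open>Algebra structures induced by an O-operator\<close>

theorem proposition2p3:
  fixes scaleA :: "'k::field_char_0 \<Rightarrow> 'a::ab_group_add \<Rightarrow> 'a"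
    and prec succ :: "'a \<Rightarrow> 'a \<Rightarrow> 'a"
    and \<alpha> \<beta> :: "'a \<Rightarrow> 'a"
    and scaleV :: "'k \<Rightarrow> 'v::ab_group_add \<Rightarrow> 'v"
    and Lprec Rprec Lsucc Rsucc :: "'a \<Rightarrow> 'v \<Rightarrow> 'v"
    and \<phi> \<psi> :: "'v \<Rightarrow> 'v"
    and T :: "'v \<Rightarrow> 'a"
    and nw sw ne se :: "'v \<Rightarrow> 'v \<Rightarrow> 'v"
  assumes algebra: "bihom_pre_alternative scaleA UNIV prec succ \<alpha> \<beta>"
    and bimodule:
      "bihom_pre_alternative_bimodule scaleA prec succ \<alpha> \<beta> scaleV Lprec Rprec Lsucc Rsucc \<phi> \<psi>"
    and O_operator:
      "bihom_O_operator scaleA prec succ \<alpha> \<beta> scaleV Lprec Rprec Lsucc Rsucc \<phi> \<psi> T"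
    and se: "\<And>u v. se u v = Lsucc (T u) v"
    and ne: "\<And>u v. ne u v = Rsucc (T v) u"
    and sw: "\<And>u v. sw u v = Lprec (T u) v"
    and nw: "\<And>u v. nw u v = Rprec (T v) u"
  shows "bihom_alternative_quadri scaleV UNIV nw sw ne se \<phi> \<psi> \<and>
         bihom_pre_alternative scaleV UNIV
           (\<lambda>u v. sw u v + nw u v) (\<lambda>u v. se u v + ne u v) \<phi> \<psi> \<and>
         bihom_pre_alternative_hom
           scaleV UNIV (\<lambda>u v. sw u v + nw u v) (\<lambda>u v. se u v + ne u v) \<phi> \<psi>
           scaleA UNIV prec succ \<alpha> \<beta> T \<and>
         bihom_pre_alternative_subalgebra scaleA UNIV prec succ \<alpha> \<beta> (range T) \<and>
         (\<exists>nw' sw' ne' se'.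
           (\<forall>u v. se' (T u) (T v) = T (se u v) \<and> ne' (T u) (T v) = T (ne u v) \<and>
                  sw' (T u) (T v) = T (sw u v) \<and> nw' (T u) (T v) = T (nw u v)) \<and>
           bihom_alternative_quadri scaleA (range T) nw' sw' ne' se' \<alpha> \<beta> \<and>
           bihom_pre_alternative scaleA (range T)
             (quadri_ops.hor_prec nw' sw') (quadri_ops.hor_succ ne' se') \<alpha> \<beta> \<and>
           (\<forall>x\<in>range T. \<forall>y\<in>range T.
              quadri_ops.hor_prec nw' sw' x y = prec x y \<and>
              quadri_ops.hor_succ ne' se' x y = succ x y) \<and>
           bihom_alternative_quadri_hom scaleV UNIV nw sw ne se \<phi> \<psi>
             scaleA (range T) nw' sw' ne' se' \<alpha> \<beta> T)"
proof -
  interpret O: bihom_O_operator scaleA prec succ \<alpha> \<beta> scaleV Lprec Rprec Lsucc Rsucc \<phi> \<psi> T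
    by fact
  have ops: "nw = O.nw" "sw = O.sw" "ne = O.ne" "se = O.se"
    by (simp_all add: fun_eq_iff nw sw ne se)
  have quadri_V: "bihom_alternative_quadri scaleV UNIV nw sw ne se \<phi> \<psi>"
    unfolding ops by (rule O.O_operator_quadri)
  then interpret V: bihom_alternative_quadri scaleV UNIV nw sw ne se \<phi> \<psi> .
  have hor: "(\<lambda>u v. sw u v + nw u v) = V.hor_prec" "(\<lambda>u v. se u v + ne u v) = V.hor_succ"
    by (simp_all add: fun_eq_iff V.hor_prec_def V.hor_succ_def add.commute)
  have T_linear: "linear_on scaleV UNIV scaleA S' T" if "range T \<subseteq> S'" for S'
    using that by (auto simp: linear_on_def O.T_add O.T_scale)
  have T_hom: "bihom_pre_alternative_hom scaleV UNIV V.hor_prec V.hor_succ \<phi> \<psi>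
      scaleA UNIV prec succ \<alpha> \<beta> T"
    using T_linear by (simp add: bihom_pre_alternative_hom_def O.T_\<phi> O.T_\<psi>
        V.hor_prec_def V.hor_succ_def nw sw ne se O.T_prec O.T_succ add.commute)
  \<comment> \<open>Preimages chosen by \<open>inv T\<close> may be replaced by any others, by \<open>T_action_cong\<close>.\<close>
  define induced :: "('v \<Rightarrow> 'v \<Rightarrow> 'v) \<Rightarrow> 'a \<Rightarrow> 'a \<Rightarrow> 'a"
    where "induced m x y = T (m (inv T x) (inv T y))" for m x y
  have T_inv: "T (inv T (T u)) = T u" for u
    by (simp add: f_inv_into_f)
  have induced: "induced nw (T u) (T v) = T (nw u v)" "induced sw (T u) (T v) = T (sw u v)"
    "induced ne (T u) (T v) = T (ne u v)" "induced se (T u) (T v) = T (se u v)" for u v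
    unfolding induced_def ops by (rule O.T_action_cong[OF T_inv T_inv])+
  have quadri_hom: "bihom_alternative_quadri_hom scaleV UNIV nw sw ne se \<phi> \<psi>
      scaleA (range T) (induced nw) (induced sw) (induced ne) (induced se) \<alpha> \<beta> T"
    using T_linear by (simp add: bihom_alternative_quadri_hom_def induced O.T_\<phi> O.T_\<psi>)
  have quadri_T: "bihom_alternative_quadri scaleA (range T)
      (induced nw) (induced sw) (induced ne) (induced se) \<alpha> \<beta>"
    using quadri_V O.A.vector_space_axioms quadri_hom by (rule bihom_alternative_quadri_image)
  then interpret I: bihom_alternative_quadri scaleA "range T"
    "induced nw" "induced sw" "induced ne" "induced se" \<alpha> \<beta> .
  have "I.hor_prec x y = prec x y \<and> I.hor_succ x y = succ x y"
    if "x \<in> range T" "y \<in> range T" for x y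
    using that by (auto simp: I.hor_prec_def I.hor_succ_def induced nw sw ne se
        O.T_prec O.T_succ O.T_add add.commute)
  with quadri_V V.horizontal_pre_alternative T_hom O.range_T_subalgebra induced quadri_T
    I.horizontal_pre_alternative quadri_hom
  show ?thesis
    unfolding hor
    by (intro conjI exI[of _ "induced nw"] exI[of _ "induced sw"] exI[of _ "induced ne"]
        exI[of _ "induced se"]) auto
qed

end
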